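(* Let $X$ be a compact doubling metric space and let $\{E_\sigma:\sigma\in\Sigma_*\}$ be a Moran construction on $X$, that is, a collection of nonempty compact subsets of a set $E_\varnothing\subset X$ such that (M1) $E_\sigma\subset E_{\sigma^-}$ for all $\sigma\in\Sigma_*$, (M2) $\operatorname{diam}(E_{\sigma|_n})\to0$ as $n\to\infty$ for all $\sigma\in\Sigma$. Assume moreover that (M3) $E_{\sigma i}\cap E_{\sigma j}=\emptyset$ for all $\sigma i,\sigma j\in\Sigma_*$ with $i\neq j$, (M4) there exists $C_0>0$ such that for each $\sigma\in\Sigma_*$ there is $x\in E_\sigma$ for which $B(x,C_0\operatorname{diam}(E_\sigma))\subset E_\sigma$, (M7) there exist $C\ge1$ and a sequence $(\beta_n)_{n\in\mathbb{N}}$ of positive real numbers with $\log\beta_n/\log\beta_{n+1}\to1$ as $n\to\infty$ such that $C^{-1}\beta_n\le\operatorname{diam}(E_\sigma)\le C\beta_n$ for all $\sigma\in\Sigma_n$ and $n\in\mathbb{N}$. If $\mu$ is a finite Borel regular measure on $\Sigma$, then $$\dim_{\mathrm{cor}}(\pi\mu)=\liminf_{n\to\infty}\frac{\log\sum_{\omega\in\Sigma_n}\mu([\omega])^2}{\log\beta_n}.$$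
   Context: Doubling. A metric space $(X,d)$ is doubling if there is $N\in\mathbb{N}$ such that every closed ball $B(x,r)$ with $x\in X$, $r>0$ can be covered by $N$ balls of radius $r/2$. $B(x,r)$ always denotes the closed ball in $X$. Symbolic notation. For each $j\in\mathbb{N}=\{1,2,\dots\}$ a nonempty finite set $I_j$ is fixed, and $\Sigma=\prod_{j=1}^\infty I_j$ carries the product of the discrete topologies. For $\sigma=i_1i_2\cdots\in\Sigma$ let $\sigma|_n=i_1\cdots i_n$; $\Sigma_n=\{\sigma|_n:\sigma\in\Sigma\}$; $\Sigma_*=\bigcup_{n=1}^\infty\Sigma_n$. For $\sigma\in\Sigma_*$, $|\sigma|$ is its length, $\sigma^-=\sigma|_{|\sigma|-1}$ is $\sigma$ with its last symbol removed (with $\sigma|_0=\varnothing$, the empty word, so for $|\sigma|=1$ the set $E_{\sigma^-}$ is $E_\varnothing$), and $[\sigma]=\{\omega\in\Sigma:\omega|_{|\sigma|}=\sigma\}$. In (M3), $\sigma i$ denotes the word $\sigma$ (possibly empty) followed by the symbol $i$. Limit set and projection. The limit set is $E=\bigcap_{n\in\mathbb{N}}\bigcup_{\sigma\in\Sigma_n}E_\sigma$. For $\sigma\in\Sigma$, $\pi(\sigma)$ denotes the single point of $\bigcap_{n\in\mathbb{N}}E_{\sigma|_n}$; the map $\pi\colon\Sigma\to E$ is a continuous surjection. $\pi\mu$ is the pushforward measure, $\pi\mu(B)=\mu(\pi^{-1}(B))$. Correlation dimension. For a finite Borel regular measure $\nu$ on $X$ and $s\ge0$ let $I_s(\nu)=\iint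 d(x,y)^{-s}\,\mathrm{d}\nu(x)\,\mathrm{d}\nu(y)$, and $$\dim_{\mathrm{cor}}(\nu)=\inf\{s:I_s(\nu)=\infty\}=\sup\{s:I_s(\nu)<\infty\}.$$ *)

theory Defs
  imports "HOL-Analysis.Analysis"
begin

text \<open>The metric space is a carrier set \<open>X\<close> in a metric-space type; its closed balls are
  the sets \<open>cball x r \<inter> X\<close> with \<open>x \<in> X\<close>.\<close>

definition doubling :: "'a::metric_space set \<Rightarrow> bool" where
  "doubling X \<longleftrightarrow>
     (\<exists>N::nat. \<forall>x\<in>X. \<forall>r>0. \<exists>P\<subseteq>X. finite P \<and> card P \<le> N \<and>
        cball x r \<inter> X \<subseteq> (\<Union>p\<in>P. cball p (r / 2) \<inter> X))"

text \<open>Positions in words start at 1. A sequence over the alphabets \<open>I 1, I 2, \<dots>\<close> is an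
  extensional function on \<open>{1..}\<close>; a finite word is a list.\<close>

definition symb_space :: "(nat \<Rightarrow> 's set) \<Rightarrow> (nat \<Rightarrow> 's) set" where
  "symb_space I = (\<Pi>\<^sub>E j\<in>{1..}. I j)"

definition symb_topology :: "(nat \<Rightarrow> 's set) \<Rightarrow> (nat \<Rightarrow> 's) topology" where
  "symb_topology I = product_topology (\<lambda>j. discrete_topology (I j)) {1..}"

definition init_word :: "(nat \<Rightarrow> 's) \<Rightarrow> nat \<Rightarrow> 's list" where
  "init_word \<sigma> n = map \<sigma> [1..<Suc n]"

definition words_of_length :: "(nat \<Rightarrow> 's set) \<Rightarrow> nat \<Rightarrow> 's list set" where
  "words_of_length I n = (\<lambda>\<sigma>. init_word \<sigma> n) ` symb_space I"

definition fin_words :: "(nat \<Rightarrow> 's set) \<Rightarrow> 's list set" where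
  "fin_words I = (\<Union>n\<in>{1..}. words_of_length I n)"

definition cylinder :: "(nat \<Rightarrow> 's set) \<Rightarrow> 's list \<Rightarrow> (nat \<Rightarrow> 's) set" where
  "cylinder I w = {\<sigma> \<in> symb_space I. init_word \<sigma> (length w) = w}"

text \<open>The value at the empty word is the set containing all the others; compactness is not
  required of it, and the empty word is not in \<open>fin_words I\<close>.\<close>

definition moran_construction ::
    "'a::metric_space set \<Rightarrow> (nat \<Rightarrow> 's set) \<Rightarrow> ('s list \<Rightarrow> 'a set) \<Rightarrow> bool" where
  "moran_construction X I E \<longleftrightarrow>
     E [] \<subseteq> X \<and>
     (\<forall>w\<in>fin_words I. E w \<noteq> {} \<and> compact (E w) \<and> E w \<subseteq> E []) \<and>
     (\<forall>w\<in>fin_words I. E w \<subseteq> E (butlast w)) \<and>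
     (\<forall>\<sigma>\<in>symb_space I. (\<lambda>n. diameter (E (init_word \<sigma> n))) \<longlonglongrightarrow> 0)"

definition moran_proj :: "('s list \<Rightarrow> 'a set) \<Rightarrow> (nat \<Rightarrow> 's) \<Rightarrow> 'a" where
  "moran_proj E \<sigma> = (THE x. x \<in> (\<Inter>n\<in>{1..}. E (init_word \<sigma> n)))"

text \<open>A Borel regular (outer) measure is determined by its restriction to the Borel sets, and
  every finite measure on the Borel sets extends to one; so it is represented by that restriction.\<close>

definition finite_borel_measure_on :: "'b topology \<Rightarrow> 'b measure \<Rightarrow> bool" where
  "finite_borel_measure_on T \<mu> \<longleftrightarrow>
     finite_measure \<mu> \<and> space \<mu> = topspace T \<and>
     sets \<mu> = sigma_sets (topspace T) {U. openin T U}"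

text \<open>The value of \<open>r\<close> to the power \<open>- s\<close> for \<open>r, s \<ge> 0\<close>, with the values at \<open>r = 0\<close>
  that integration theory requires; \<open>powr\<close> itself has \<open>0 powr a = 0\<close> for all \<open>a\<close>.\<close>

definition neg_power :: "real \<Rightarrow> real \<Rightarrow> ennreal" where
  "neg_power r s =
     (if r = 0 then (if s = 0 then 1 else \<infinity>) else ennreal (r powr (- s)))"

definition energy :: "real \<Rightarrow> 'a::metric_space measure \<Rightarrow> ennreal" where
  "energy s \<nu> = (\<integral>\<^sup>+ y. (\<integral>\<^sup>+ x. neg_power (dist x y) s \<partial>\<nu>) \<partial>\<nu>)"

text \<open>The infimum of the empty set is \<open>\<infinity>\<close>.\<close>

definition dim_cor :: "'a::metric_space measure \<Rightarrow> ereal" where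
  "dim_cor \<nu> = (INF s\<in>{s. 0 \<le> s \<and> energy s \<nu> = \<infinity>}. ereal s)"

text \<open>Logarithm of a nonnegative real with \<open>log 0 = -\<infinity>\<close> (whereas \<open>ln 0 = 0\<close> in the library).
  This value only matters for the zero measure, whose correlation dimension is \<open>\<infinity>\<close>.\<close>

definition elog :: "real \<Rightarrow> ereal" where
  "elog x = (if x = 0 then - \<infinity> else ereal (ln x))"

end

theory Submission
  imports Defs
begin

text \<open>Write \<open>\<nu> = \<pi>\<mu>\<close> and let \<open>S n\<close> be the sum of \<open>\<mu>([w])\<^sup>2\<close> over the words \<open>w\<close> of length \<open>n\<close>.
  Two points of a common \<open>E w\<close> are at distance at most \<open>C \<beta> n\<close>, so the energy of order \<open>s\<close> is at
  least \<open>(C \<beta> n) powr - s * S n\<close>. Conversely, the sets \<open>E w\<close> of level \<open>n\<close> contain disjoint balls of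
  radius comparable to \<open>\<beta> n\<close>, so by doubling each of them has at most \<open>M\<close> neighbours at distance
  \<open>\<beta> n\<close>, and \<open>2ab \<le> a\<^sup>2 + b\<^sup>2\<close> bounds the mass that \<open>\<nu> \<times> \<nu>\<close> gives to the pairs at distance at most
  \<open>\<beta> n\<close> by \<open>M * S n\<close>. The hypothesis on \<open>ln (\<beta> n) / ln (\<beta> (Suc n))\<close> allows passing from the scales
  \<open>\<beta> n\<close>, which need not decay geometrically, to dyadic ones, where the energy is a geometric
  series.\<close>

subsection \<open>Packing in doubling spaces\<close>

text \<open>Naming the constant \<open>N\<close> makes it possible to fix it in a locale and to
  state counting bounds as explicit powers of it.\<close>

definition doubling_with :: "nat \<Rightarrow> 'a::metric_space set \<Rightarrow> bool" where
  "doubling_with N X \<longleftrightarrow>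
     (\<forall>x\<in>X. \<forall>r>0. \<exists>P\<subseteq>X. finite P \<and> card P \<le> N \<and>
        cball x r \<inter> X \<subseteq> (\<Union>p\<in>P. cball p (r / 2) \<inter> X))"

lemma doubling_iff_doubling_with: "doubling X \<longleftrightarrow> (\<exists>N. doubling_with N X)"
  unfolding doubling_def doubling_with_def ..

text \<open>Each of the \<open>k\<close> halvings of the radius replaces every ball by at most
  \<open>N\<close> smaller ones.\<close>

lemma doubling_with_cover:
  assumes "doubling_with N X" "x \<in> X" "r > 0"
  shows "\<exists>P\<subseteq>X. finite P \<and> card P \<le> N ^ k \<and>
           cball x r \<inter> X \<subseteq> (\<Union>p\<in>P. cball p (r / 2 ^ k) \<inter> X)"
proof (induction k)
  case 0
  show ?case by (rule exI[of _ "{x}"]) (simp add: assms(2))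
next
  case (Suc k)
  then obtain P where P: "P \<subseteq> X" "finite P" "card P \<le> N ^ k"
      and cov: "cball x r \<inter> X \<subseteq> (\<Union>p\<in>P. cball p (r / 2 ^ k) \<inter> X)"
    by blast
  have "\<forall>p\<in>P. \<exists>Q\<subseteq>X. finite Q \<and> card Q \<le> N \<and>
          cball p (r / 2 ^ k) \<inter> X \<subseteq> (\<Union>q\<in>Q. cball q (r / 2 ^ k / 2) \<inter> X)"
  proof
    fix p assume "p \<in> P"
    then have "p \<in> X" "r / 2 ^ k > 0" using P(1) assms(3) by auto
    then show "\<exists>Q\<subseteq>X. finite Q \<and> card Q \<le> N \<and>
          cball p (r / 2 ^ k) \<inter> X \<subseteq> (\<Union>q\<in>Q. cball q (r / 2 ^ k / 2) \<inter> X)"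
      using assms(1) unfolding doubling_with_def by blast
  qed
  then obtain Q where Q: "\<And>p. p \<in> P \<Longrightarrow> Q p \<subseteq> X" "\<And>p. p \<in> P \<Longrightarrow> finite (Q p)"
      "\<And>p. p \<in> P \<Longrightarrow> card (Q p) \<le> N"
      "\<And>p. p \<in> P \<Longrightarrow> cball p (r / 2 ^ k) \<inter> X \<subseteq> (\<Union>q\<in>Q p. cball q (r / 2 ^ k / 2) \<inter> X)"
    by metis
  have "card (\<Union>p\<in>P. Q p) \<le> (\<Sum>p\<in>P. card (Q p))"
    using P(2) by (rule card_UN_le)
  also have "\<dots> \<le> card P * N"
    using Q(3) by (metis sum_bounded_above of_nat_id)
  also have "\<dots> \<le> N ^ Suc k"
    using P(3) by simp
  finally have "card (\<Union>p\<in>P. Q p) \<le> N ^ Suc k" .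
  moreover have "cball x r \<inter> X \<subseteq> (\<Union>q\<in>(\<Union>p\<in>P. Q p). cball q (r / 2 ^ Suc k) \<inter> X)"
  proof
    fix y assume "y \<in> cball x r \<inter> X"
    then obtain p where "p \<in> P" "y \<in> cball p (r / 2 ^ k) \<inter> X" using cov by blast
    then obtain q where "q \<in> Q p" "y \<in> cball q (r / 2 ^ k / 2) \<inter> X" using Q(4) by blast
    then show "y \<in> (\<Union>q\<in>(\<Union>p\<in>P. Q p). cball q (r / 2 ^ Suc k) \<inter> X)"
      using \<open>p \<in> P\<close> by (auto simp: mult.commute)
  qed
  ultimately show ?case
    using P(2) Q(1,2) by (intro exI[of _ "\<Union>p\<in>P. Q p"]) blast
qed

text \<open>Pigeonhole: two points in one of the \<open>N ^ k\<close> covering balls are at distance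
  at most \<open>2 * r / 2 ^ k\<close>, so by \<open>sep\<close> each ball captures at most one
  point of \<open>A\<close>.\<close>

lemma doubling_with_packing:
  assumes "doubling_with N X" "x \<in> X" "r > 0" "A \<subseteq> cball x r \<inter> X"
    and sep: "\<And>a b. a \<in> A \<Longrightarrow> b \<in> A \<Longrightarrow> a \<noteq> b \<Longrightarrow> 2 * r / 2 ^ k < dist a b"
  shows "finite A \<and> card A \<le> N ^ k"
proof -
  obtain P where P: "finite P" "card P \<le> N ^ k"
      and cov: "cball x r \<inter> X \<subseteq> (\<Union>p\<in>P. cball p (r / 2 ^ k) \<inter> X)"
    using doubling_with_cover[OF assms(1-3)] by metis
  have "\<forall>a\<in>A. \<exists>p\<in>P. dist p a \<le> r / 2 ^ k"
    using cov assms(4) by fastforce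
  then obtain f where f: "\<And>a. a \<in> A \<Longrightarrow> f a \<in> P" "\<And>a. a \<in> A \<Longrightarrow> dist (f a) a \<le> r / 2 ^ k"
    by metis
  have inj: "inj_on f A"
  proof (rule inj_onI, rule ccontr)
    fix a b assume ab: "a \<in> A" "b \<in> A" "f a = f b" "a \<noteq> b"
    have "dist a b \<le> dist (f a) a + dist (f a) b" by (simp add: dist_triangle3)
    also have "\<dots> \<le> 2 * r / 2 ^ k" using f(2)[OF ab(1)] f(2)[OF ab(2)] ab(3) by simp
    finally show False using sep[OF ab(1,2,4)] by simp
  qed
  have sub: "f ` A \<subseteq> P" using f(1) by blast
  have "finite A" by (rule inj_on_finite[OF inj sub P(1)])
  moreover have "card A \<le> card P" by (rule card_inj_on_le[OF inj sub P(1)])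
  ultimately show ?thesis using P(2) by simp
qed

text \<open>Think of \<open>R\<close> as the edges of a graph on \<open>W\<close> with degrees at
  most \<open>M\<close>. After \<open>2ab \<le> a\<^sup>2 + b\<^sup>2\<close>, each
  \<open>(a w)\<^sup>2\<close> is counted once per neighbour of \<open>w\<close> in either half of
  the sum; for the second half this requires exchanging the sums and using the symmetry of
  \<open>R\<close>.\<close>

lemma sum_bounded_degree_le:
  fixes a :: "'w \<Rightarrow> real"
  assumes "finite W" and sym: "\<And>v w. R v w \<Longrightarrow> R w v"
    and deg: "\<And>w. w \<in> W \<Longrightarrow> card {v\<in>W. R w v} \<le> M"
  shows "(\<Sum>w\<in>W. a w * (\<Sum>v | v \<in> W \<and> R w v. a v)) \<le> real M * (\<Sum>w\<in>W. (a w)\<^sup>2)"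
proof -
  have sq: "(\<Sum>w\<in>W. \<Sum>v | v \<in> W \<and> R w v. (a w)\<^sup>2) \<le> real M * (\<Sum>w\<in>W. (a w)\<^sup>2)"
    using deg by (auto simp: sum_distrib_left intro!: sum_mono mult_right_mono)
  have swap: "(\<Sum>w\<in>W. \<Sum>v | v \<in> W \<and> R w v. (a v)\<^sup>2) = (\<Sum>v\<in>W. \<Sum>w | w \<in> W \<and> R v w. (a v)\<^sup>2)"
  proof -
    have "{w. w \<in> W \<and> R w v} = {w. w \<in> W \<and> R v w}" for v using sym by blast
    then show ?thesis
      using sum.swap_restrict[OF assms(1) assms(1), of "\<lambda>w v. (a v)\<^sup>2" R] by simp
  qed
  have "(\<Sum>w\<in>W. a w * (\<Sum>v | v \<in> W \<and> R w v. a v)) = (\<Sum>w\<in>W. \<Sum>v | v \<in> W \<and> R w v. a w * a v)"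
    by (simp add: sum_distrib_left)
  also have "\<dots> \<le> (\<Sum>w\<in>W. \<Sum>v | v \<in> W \<and> R w v. ((a w)\<^sup>2 + (a v)\<^sup>2) / 2)"
  proof (intro sum_mono)
    fix v w show "a w * a v \<le> ((a w)\<^sup>2 + (a v)\<^sup>2) / 2"
      using sum_squares_bound[of "a w" "a v"] by simp
  qed
  also have "\<dots> = ((\<Sum>w\<in>W. \<Sum>v | v \<in> W \<and> R w v. (a w)\<^sup>2) + (\<Sum>w\<in>W. \<Sum>v | v \<in> W \<and> R w v. (a v)\<^sup>2)) / 2"
    by (simp add: sum.distrib sum_divide_distrib add_divide_distrib)
  also have "\<dots> \<le> real M * (\<Sum>w\<in>W. (a w)\<^sup>2)"
    using sq swap by simp
  finally show ?thesis .
qed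

subsection \<open>Words and cylinders\<close>

lemma length_init_word [simp]: "length (init_word \<sigma> n) = n"
  by (simp add: init_word_def)

lemma init_word_Suc: "init_word \<sigma> (Suc n) = init_word \<sigma> n @ [\<sigma> (Suc n)]"
  by (simp add: init_word_def)

lemma length_words_of_length: "w \<in> words_of_length I n \<Longrightarrow> length w = n"
  by (auto simp: words_of_length_def)

lemma init_word_in_words_of_length: "\<sigma> \<in> symb_space I \<Longrightarrow> init_word \<sigma> n \<in> words_of_length I n"
  by (simp add: words_of_length_def)

lemma words_of_length_subset_fin_words: "n \<ge> 1 \<Longrightarrow> words_of_length I n \<subseteq> fin_words I"
  by (auto simp: fin_words_def)

lemma init_word_eq_iff: "init_word \<sigma> n = init_word \<tau> n \<longleftrightarrow> (\<forall>j\<in>{1..n}. \<sigma> j = \<tau> j)"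
  by (auto simp: init_word_def)

lemma finite_words_of_length:
  assumes "\<forall>j\<ge>1. finite (I j) \<and> I j \<noteq> {}"
  shows "finite (words_of_length I n)"
proof (induction n)
  case 0
  have "words_of_length I 0 \<subseteq> {[]}" by (auto simp: words_of_length_def init_word_def)
  then show ?case by (rule finite_subset) simp
next
  case (Suc n)
  have "words_of_length I (Suc n) \<subseteq> (\<lambda>(w, i). w @ [i]) ` (words_of_length I n \<times> I (Suc n))"
    by (auto simp: words_of_length_def init_word_Suc symb_space_def)
  then show ?case using Suc assms by (auto intro: finite_subset)
qed

lemma countable_fin_words:
  assumes "\<forall>j\<ge>1. finite (I j) \<and> I j \<noteq> {}"
  shows "countable (fin_words I)"
  unfolding fin_words_def
  by (simp add: countable_finite finite_words_of_length[OF assms])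

lemma topspace_symb_topology: "topspace (symb_topology I) = symb_space I"
  by (simp add: symb_topology_def symb_space_def)

lemma openin_cylinder:
  assumes "w \<in> words_of_length I n"
  shows "openin (symb_topology I) (cylinder I w)"
proof -
  obtain \<tau> where \<tau>: "\<tau> \<in> symb_space I" "w = init_word \<tau> n"
    using assms by (auto simp: words_of_length_def)
  let ?S = "\<lambda>j. if j \<le> n then {\<tau> j} else I j"
  have "cylinder I w = PiE {1..} ?S"
  proof (rule set_eqI)
    fix \<sigma>
    have "\<sigma> \<in> cylinder I w \<longleftrightarrow> \<sigma> \<in> symb_space I \<and> (\<forall>j\<in>{1..n}. \<sigma> j = \<tau> j)"
      by (simp add: cylinder_def \<tau>(2) init_word_eq_iff)
    also have "\<dots> \<longleftrightarrow> \<sigma> \<in> PiE {1..} ?S"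
      using \<tau>(1) by (auto simp: symb_space_def PiE_iff split: if_splits)
    finally show "\<sigma> \<in> cylinder I w \<longleftrightarrow> \<sigma> \<in> PiE {1..} ?S" .
  qed
  moreover have "finite {j \<in> {1..}. ?S j \<noteq> I j}"
    by (rule finite_subset[of _ "{..n}"]) auto
  moreover have "\<forall>j\<in>{1..}. ?S j \<subseteq> I j"
    using \<tau> by (auto simp: symb_space_def PiE_iff)
  ultimately show ?thesis
    by (simp add: symb_topology_def openin_PiE_gen)
qed

subsection \<open>Moran constructions with disjoint siblings\<close>

locale disjoint_moran =
  fixes X :: "'a::metric_space set" and I :: "nat \<Rightarrow> 's set" and E :: "'s list \<Rightarrow> 'a set"
  assumes alphabets: "\<forall>j\<ge>1. finite (I j) \<and> I j \<noteq> {}"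
    and moran: "moran_construction X I E"
    and M3: "\<forall>w i j. w @ [i] \<in> fin_words I \<and> w @ [j] \<in> fin_words I \<and> i \<noteq> j \<longrightarrow>
               E (w @ [i]) \<inter> E (w @ [j]) = {}"
begin

lemma fin_wordsI: "n \<ge> 1 \<Longrightarrow> w \<in> words_of_length I n \<Longrightarrow> w \<in> fin_words I"
  using words_of_length_subset_fin_words by blast

lemma compact_E: "w \<in> fin_words I \<Longrightarrow> compact (E w)"
  and E_nonempty: "w \<in> fin_words I \<Longrightarrow> E w \<noteq> {}"
  and E_subset_X: "w \<in> fin_words I \<Longrightarrow> E w \<subseteq> X"
  using moran unfolding moran_construction_def by blast+

lemma diameter_E_tendsto_0: "\<sigma> \<in> symb_space I \<Longrightarrow> (\<lambda>n. diameter (E (init_word \<sigma> n))) \<longlonglongrightarrow> 0"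
  using moran unfolding moran_construction_def by blast

lemma dist_le_diameter_E: "w \<in> fin_words I \<Longrightarrow> x \<in> E w \<Longrightarrow> y \<in> E w \<Longrightarrow> dist x y \<le> diameter (E w)"
  using compact_E compact_imp_bounded diameter_bounded_bound by blast

lemma symb_space_nonempty: "symb_space I \<noteq> {}"
  unfolding symb_space_def using alphabets by (simp add: PiE_eq_empty_iff)

lemma init_word_fin_words: "\<sigma> \<in> symb_space I \<Longrightarrow> n \<ge> 1 \<Longrightarrow> init_word \<sigma> n \<in> fin_words I"
  using fin_wordsI init_word_in_words_of_length by blast

lemma E_init_word_Suc:
  assumes "\<sigma> \<in> symb_space I"
  shows "E (init_word \<sigma> (Suc n)) \<subseteq> E (init_word \<sigma> n)"
proof -
  have "E (init_word \<sigma> (Suc n)) \<subseteq> E (butlast (init_word \<sigma> (Suc n)))"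
    using moran init_word_fin_words[OF assms, of "Suc n"] unfolding moran_construction_def by force
  then show ?thesis by (simp add: init_word_Suc)
qed

lemma E_init_word_antimono:
  "\<sigma> \<in> symb_space I \<Longrightarrow> m \<le> n \<Longrightarrow> E (init_word \<sigma> n) \<subseteq> E (init_word \<sigma> m)"
  by (rule lift_Suc_antimono_le[of "\<lambda>n. E (init_word \<sigma> n)"]) (auto dest: E_init_word_Suc)

text \<open>(M3) concerns siblings only. Where two words first differ they pass through siblings,
  and nestedness hands the disjointness down to all later levels.\<close>

lemma disjoint_E_init_word:
  assumes "\<sigma> \<in> symb_space I" "\<tau> \<in> symb_space I" "init_word \<sigma> n \<noteq> init_word \<tau> n"
  shows "E (init_word \<sigma> n) \<inter> E (init_word \<tau> n) = {}"
  using assms(3)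
proof (induction n)
  case 0
  then show ?case by (simp add: init_word_def)
next
  case (Suc n)
  show ?case
  proof (cases "init_word \<sigma> n = init_word \<tau> n")
    case True
    then show ?thesis
      using Suc.prems M3 init_word_fin_words[OF assms(1), of "Suc n"]
        init_word_fin_words[OF assms(2), of "Suc n"]
      by (auto simp: init_word_Suc)
  next
    case False
    then show ?thesis
      using Suc.IH E_init_word_Suc assms(1,2) by blast
  qed
qed

lemma disjoint_E:
  "v \<in> words_of_length I n \<Longrightarrow> w \<in> words_of_length I n \<Longrightarrow> v \<noteq> w \<Longrightarrow> E v \<inter> E w = {}"
  using disjoint_E_init_word by (auto simp: words_of_length_def)

section \<open>The projection and the preimages of open sets\<close>

lemma moran_proj_eqI:
  assumes \<sigma>: "\<sigma> \<in> symb_space I" and x: "\<And>n. n \<ge> 1 \<Longrightarrow> x \<in> E (init_word \<sigma> n)"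
  shows "moran_proj E \<sigma> = x"
  unfolding moran_proj_def
proof (rule the_equality)
  show "x \<in> (\<Inter>n\<in>{1..}. E (init_word \<sigma> n))" using x by auto
  fix y assume "y \<in> (\<Inter>n\<in>{1..}. E (init_word \<sigma> n))"
  then have "\<forall>n\<ge>1. dist x y \<le> diameter (E (init_word \<sigma> n))"
    using x \<sigma> dist_le_diameter_E init_word_fin_words by auto
  then have "dist x y \<le> 0"
    using LIMSEQ_le_const[OF diameter_E_tendsto_0[OF \<sigma>]] by blast
  then show "y = x" by simp
qed

lemma moran_proj_in_E:
  assumes \<sigma>: "\<sigma> \<in> symb_space I" and "n \<ge> 1"
  shows "moran_proj E \<sigma> \<in> E (init_word \<sigma> n)"
proof -
  \<comment> \<open>The finite intersection property, inside the compact set of level 1, yields a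
    point common to all levels; by \<open>moran_proj_eqI\<close> it is the projection.\<close>
  have "E (init_word \<sigma> 1) \<inter> (\<Inter>n\<in>{1..}. E (init_word \<sigma> n)) \<noteq> {}"
  proof (rule compact_imp_fip_image)
    show "compact (E (init_word \<sigma> 1))" using compact_E init_word_fin_words[OF \<sigma>] by simp
    show "closed (E (init_word \<sigma> n))" if "n \<in> {1..}" for n
      using that compact_E init_word_fin_words[OF \<sigma>] by (simp add: compact_imp_closed)
    fix J :: "nat set" assume J: "finite J" "J \<subseteq> {1..}"
    \<comment> \<open>A level beyond all those in \<open>J\<close>, and at least 1 even if
      \<open>J\<close> is empty; by nestedness its set lies in the whole finite
      intersection.\<close>
    define m where "m = Suc (\<Sum>J)"
    have "j \<le> m" if "j \<in> J" for j using member_le_sum[OF that, of "\<lambda>j. j"] J by (simp add: m_def)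
    then have "E (init_word \<sigma> m) \<subseteq> E (init_word \<sigma> 1) \<inter> (\<Inter>n\<in>J. E (init_word \<sigma> n))"
      using E_init_word_antimono[OF \<sigma>] by (simp add: m_def le_INF_iff)
    moreover have "E (init_word \<sigma> m) \<noteq> {}"
      using E_nonempty init_word_fin_words[OF \<sigma>] by (simp add: m_def)
    ultimately show "E (init_word \<sigma> 1) \<inter> (\<Inter>n\<in>J. E (init_word \<sigma> n)) \<noteq> {}" by blast
  qed
  then obtain x where "\<And>n. n \<ge> 1 \<Longrightarrow> x \<in> E (init_word \<sigma> n)" by auto
  then show ?thesis using moran_proj_eqI[OF \<sigma>] assms(2) by metis
qed

text \<open>This is where disjointness enters the measure theory: the preimage of \<open>E w\<close>
  is exactly the cylinder of \<open>w\<close>, so the projected measure gives \<open>E w\<close> the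
  mass of that cylinder.\<close>

lemma moran_proj_in_E_iff:
  assumes "\<sigma> \<in> symb_space I" "n \<ge> 1" "w \<in> words_of_length I n"
  shows "moran_proj E \<sigma> \<in> E w \<longleftrightarrow> \<sigma> \<in> cylinder I w"
proof
  assume "moran_proj E \<sigma> \<in> E w"
  then have "init_word \<sigma> n = w"
    using disjoint_E[OF init_word_in_words_of_length[OF assms(1)] assms(3)]
      moran_proj_in_E[OF assms(1,2)] by blast
  then show "\<sigma> \<in> cylinder I w" using assms by (auto simp: cylinder_def)
next
  assume "\<sigma> \<in> cylinder I w"
  then show "moran_proj E \<sigma> \<in> E w"
    using moran_proj_in_E[OF assms(1,2)] assms(3) by (simp add: cylinder_def length_words_of_length)
qed

text \<open>Diameters along a sequence tend to 0, so a small enough \<open>E w\<close> around the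
  projected point fits into \<open>U\<close>. The union is countable and its members are open
  cylinders, which gives measurability of the projection.\<close>

lemma moran_proj_vimage_open:
  assumes "open U"
  shows "moran_proj E -` U \<inter> symb_space I = (\<Union>w\<in>{w\<in>fin_words I. E w \<subseteq> U}. cylinder I w)"
proof (intro equalityI subsetI)
  fix \<sigma> assume "\<sigma> \<in> moran_proj E -` U \<inter> symb_space I"
  then have \<sigma>: "\<sigma> \<in> symb_space I" and "moran_proj E \<sigma> \<in> U" by auto
  then obtain e where e: "e > 0" "ball (moran_proj E \<sigma>) e \<subseteq> U"
    using assms open_contains_ball by blast
  have "eventually (\<lambda>n. diameter (E (init_word \<sigma> n)) < e \<and> n \<ge> 1) sequentially"
    using order_tendstoD(2)[OF diameter_E_tendsto_0[OF \<sigma>] e(1)] eventually_ge_at_top[of 1]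
    by (rule eventually_conj)
  then obtain n where n: "diameter (E (init_word \<sigma> n)) < e" "n \<ge> 1"
    using eventually_happens trivial_limit_sequentially by blast
  have "E (init_word \<sigma> n) \<subseteq> ball (moran_proj E \<sigma>) e"
    using dist_le_diameter_E[OF init_word_fin_words[OF \<sigma> n(2)] moran_proj_in_E[OF \<sigma> n(2)]] n(1)
    by force
  then show "\<sigma> \<in> (\<Union>w\<in>{w\<in>fin_words I. E w \<subseteq> U}. cylinder I w)"
    using e(2) init_word_fin_words[OF \<sigma> n(2)] \<sigma>
    by (intro UN_I[of "init_word \<sigma> n"]) (auto simp: cylinder_def)
next
  fix \<sigma> assume "\<sigma> \<in> (\<Union>w\<in>{w\<in>fin_words I. E w \<subseteq> U}. cylinder I w)"
  then obtain w n where w: "n \<ge> 1" "w \<in> words_of_length I n" "E w \<subseteq> U" "\<sigma> \<in> cylinder I w"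
    by (auto simp: fin_words_def)
  then have "\<sigma> \<in> symb_space I" by (simp add: cylinder_def)
  then show "\<sigma> \<in> moran_proj E -` U \<inter> symb_space I"
    using moran_proj_in_E_iff w by auto
qed

end

subsection \<open>The projected measure\<close>

lemma neg_power_ge:
  assumes "0 \<le> d" "d \<le> r" "0 < r" "0 \<le> s"
  shows "ennreal (r powr - s) \<le> neg_power d s"
proof (cases "d = 0")
  case True
  then show ?thesis using assms by (simp add: neg_power_def)
next
  case False
  then show ?thesis using assms
    by (auto simp: neg_power_def intro!: ennreal_leI powr_mono2')
qed

text \<open>At \<open>d = 0\<close> the series diverges, which covers the diagonal.\<close>

lemma neg_power_le_suminf:
  fixes \<rho> s d :: real
  assumes "0 < \<rho>" "0 \<le> s" "0 \<le> d"
  shows "neg_power d s \<le>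
    ennreal (\<rho> powr - s) +
    (\<Sum>j. ennreal ((\<rho> / 2 ^ Suc j) powr - s) * (if d \<le> \<rho> / 2 ^ j then 1 else 0))"
    (is "_ \<le> _ + (\<Sum>j. ?f j)")
proof -
  have le_sum: "?f j \<le> (\<Sum>j. ?f j)" for j
    using sum_le_suminf[OF summableI, of "{j}" ?f] by simp
  consider "d = 0" | "\<rho> < d" | "0 < d" "d \<le> \<rho>" using assms by linarith
  then show ?thesis
  proof cases
    case 1
    have "(\<Sum>j::nat. ennreal (\<rho> powr - s)) = top"
    proof (rule ccontr)
      assume "(\<Sum>j::nat. ennreal (\<rho> powr - s)) \<noteq> top"
      then have "summable (\<lambda>_::nat. \<rho> powr - s)"
        by (rule summable_suminf_not_top[rotated]) (rule powr_ge_zero)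
      then show False using assms(1) by (simp add: summable_const_iff)
    qed
    then have "top = (\<Sum>j::nat. ennreal (\<rho> powr - s))" by (rule sym)
    also have "\<dots> \<le> (\<Sum>j. ?f j)"
    proof (intro suminf_le summableI)
      fix j
      have "\<rho> / 2 ^ Suc j \<le> \<rho>"
        using divide_left_mono[of 1 "2 ^ Suc j" \<rho>] one_le_power[of "2::real" "Suc j"] assms(1)
        by (simp del: power_Suc)
      then have "\<rho> powr - s \<le> (\<rho> / 2 ^ Suc j) powr - s"
        using assms by (intro powr_mono2') auto
      then show "ennreal (\<rho> powr - s) \<le> ?f j"
        using 1 assms(1) by (auto intro: ennreal_leI)
    qed
    finally have "(\<Sum>j. ?f j) = top" by (rule top_unique[THEN iffD1])
    then show ?thesis by (simp only: add_top_right_ennreal top_greatest)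
  next
    case 2
    then have "d powr - s \<le> \<rho> powr - s"
      using assms by (intro powr_mono2') auto
    then have "neg_power d s \<le> ennreal (\<rho> powr - s)"
      using 2 assms by (auto simp: neg_power_def intro: ennreal_leI)
    then show ?thesis by (rule order_trans) simp
  next
    case 3
    have "\<exists>j. \<rho> / 2 ^ j < d"
    proof -
      obtain j where "(1 / 2) ^ j < d / \<rho>"
        using real_arch_pow_inv[of "d / \<rho>" "1 / 2"] 3 assms by auto
      then show ?thesis using assms(1) by (auto simp: field_simps power_divide)
    qed
    \<comment> \<open>Since \<open>d \<le> \<rho>\<close>, the exponent found above cannot be 0 and
      is a successor.\<close>
    then have ex: "\<exists>j. \<rho> / 2 ^ Suc j < d"
      using 3 by (metis not0_implies_Suc not_less div_by_1 power_0)
    \<comment> \<open>Minimality places \<open>d\<close> in the dyadic shell between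
      \<open>\<rho> / 2 ^ Suc j\<close> and \<open>\<rho> / 2 ^ j\<close>, where the single term
      \<open>?f j\<close> already dominates the kernel.\<close>
    define j where "j = (LEAST j. \<rho> / 2 ^ Suc j < d)"
    have j: "\<rho> / 2 ^ Suc j < d" unfolding j_def by (rule LeastI_ex[OF ex])
    have "d \<le> \<rho> / 2 ^ j"
    proof (cases j)
      case 0
      then show ?thesis using 3 by simp
    next
      case (Suc i)
      then have "\<not> \<rho> / 2 ^ Suc i < d" unfolding j_def by (metis lessI not_less_Least)
      then show ?thesis using Suc by simp
    qed
    then have "ennreal (d powr - s) \<le> ?f j"
      using assms j by (auto intro!: ennreal_leI powr_mono2')
    then have "neg_power d s \<le> (\<Sum>j. ?f j)"
      using le_sum[of j] 3 by (simp add: neg_power_def)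
    then show ?thesis by (rule order_trans) simp
  qed
qed

locale moran_measure = disjoint_moran X I E
  for X :: "'a::metric_space set" and I :: "nat \<Rightarrow> 's set" and E :: "'s list \<Rightarrow> 'a set" +
  fixes \<mu> :: "(nat \<Rightarrow> 's) measure"
  assumes measure: "finite_borel_measure_on (symb_topology I) \<mu>"
begin

definition \<nu> :: "'a measure" where
  "\<nu> = distr \<mu> (restrict_space borel X) (moran_proj E)"

definition mass :: "'s list \<Rightarrow> real" where
  "mass w = Sigma_Algebra.measure \<mu> (cylinder I w)"

definition sum_sq_mass :: "nat \<Rightarrow> real" where
  "sum_sq_mass n = (\<Sum>w\<in>words_of_length I n. (mass w)\<^sup>2)"

sublocale finite_measure \<mu>
  using measure by (simp add: finite_borel_measure_on_def)

lemma mass_nonneg [simp]: "0 \<le> mass w"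
  by (simp add: mass_def)

lemma sum_sq_mass_nonneg: "0 \<le> sum_sq_mass n"
  by (simp add: sum_sq_mass_def sum_nonneg)

lemma finite_words [simp]: "finite (words_of_length I n)"
  by (rule finite_words_of_length[OF alphabets])

lemma space_\<mu>: "space \<mu> = symb_space I"
  using measure by (simp add: finite_borel_measure_on_def topspace_symb_topology)

lemma openin_imp_sets_\<mu>: "openin (symb_topology I) U \<Longrightarrow> U \<in> sets \<mu>"
  using measure by (auto simp: finite_borel_measure_on_def)

lemma cylinder_sets [measurable]: "w \<in> words_of_length I n \<Longrightarrow> cylinder I w \<in> sets \<mu>"
  by (rule openin_imp_sets_\<mu>[OF openin_cylinder])

lemma moran_proj_in_X: "\<sigma> \<in> symb_space I \<Longrightarrow> moran_proj E \<sigma> \<in> X"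
  using moran_proj_in_E[of \<sigma> 1] E_subset_X init_word_fin_words[of \<sigma> 1] by auto

lemma moran_proj_measurable: "moran_proj E \<in> \<mu> \<rightarrow>\<^sub>M restrict_space borel X"
proof (rule measurable_restrict_space2)
  show "moran_proj E \<in> space \<mu> \<rightarrow> X" using moran_proj_in_X by (auto simp: space_\<mu>)
  show "moran_proj E \<in> borel_measurable \<mu>"
  proof (rule borel_measurableI)
    fix U :: "'a set" assume "open U"
    have "cylinder I w \<in> sets \<mu>" if "w \<in> fin_words I" for w
      using that cylinder_sets by (auto simp: fin_words_def)
    then show "moran_proj E -` U \<inter> space \<mu> \<in> sets \<mu>"
      unfolding space_\<mu> moran_proj_vimage_open[OF \<open>open U\<close>]
      by (intro sets.countable_UN' countable_subset[OF _ countable_fin_words[OF alphabets]]) auto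
  qed
qed

lemma closed_Int_X_sets_\<nu>: "closed K \<Longrightarrow> K \<inter> X \<in> sets \<nu>"
  unfolding \<nu>_def sets_distr sets_restrict_space
  by (rule image_eqI[of _ _ K]) (simp_all add: Int_commute)

lemma E_sets_\<nu>: "n \<ge> 1 \<Longrightarrow> w \<in> words_of_length I n \<Longrightarrow> E w \<in> sets \<nu>"
  using closed_Int_X_sets_\<nu>[of "E w"] compact_E[of w] E_subset_X[of w] fin_wordsI[of n w]
  by (simp add: compact_imp_closed Int_absorb2)

lemma emeasure_\<nu>_E:
  assumes "n \<ge> 1" "w \<in> words_of_length I n"
  shows "emeasure \<nu> (E w) = ennreal (mass w)"
proof -
  have "moran_proj E -` E w \<inter> space \<mu> = cylinder I w"
    using moran_proj_in_E_iff[OF _ assms] by (auto simp: space_\<mu> cylinder_def)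
  then show ?thesis
    using E_sets_\<nu>[OF assms] moran_proj_measurable
    unfolding \<nu>_def by (subst emeasure_distr) (auto simp: mass_def emeasure_eq_measure)
qed

lemma finite_measure_\<nu>: "finite_measure \<nu>"
  unfolding \<nu>_def by (rule finite_measure_distr[OF moran_proj_measurable])

text \<open>The sets of a level may leave part of \<open>X\<close> uncovered, but they carry all of
  \<open>\<nu>\<close>, because every projected point lies in one of them.\<close>

lemma AE_\<nu>_in_E:
  assumes "n \<ge> 1"
  shows "AE y in \<nu>. \<exists>w\<in>words_of_length I n. y \<in> E w"
proof -
  have "{y \<in> space (restrict_space borel X). \<exists>w\<in>words_of_length I n. y \<in> E w}
      = (\<Union>w\<in>words_of_length I n. E w)"
    using E_subset_X fin_wordsI[OF assms] by (auto simp: space_restrict_space)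
  moreover have "(\<Union>w\<in>words_of_length I n. E w) \<in> sets (restrict_space borel X)"
    using E_sets_\<nu>[OF assms] by (intro sets.finite_UN) (auto simp: \<nu>_def)
  ultimately show ?thesis
    unfolding \<nu>_def
    by (subst AE_distr_iff[OF moran_proj_measurable])
      (use moran_proj_in_E[OF _ assms] init_word_in_words_of_length in \<open>force simp: space_\<mu>\<close>)+
qed

lemma nn_integral_simple_E:
  assumes "n \<ge> 1"
  shows "(\<integral>\<^sup>+ y. (\<Sum>w\<in>words_of_length I n. ennreal (c w) * indicator (E w) y) \<partial>\<nu>)
           = (\<Sum>w\<in>words_of_length I n. ennreal (c w) * ennreal (mass w))"
proof -
  have [measurable]: "E w \<in> sets \<nu>" if "w \<in> words_of_length I n" for w
    using that by (rule E_sets_\<nu>[OF assms])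
  have "(\<integral>\<^sup>+ y. (\<Sum>w\<in>words_of_length I n. ennreal (c w) * indicator (E w) y) \<partial>\<nu>)
      = (\<Sum>w\<in>words_of_length I n. \<integral>\<^sup>+ y. ennreal (c w) * indicator (E w) y \<partial>\<nu>)"
    by (rule nn_integral_sum) measurable
  also have "\<dots> = (\<Sum>w\<in>words_of_length I n. ennreal (c w) * ennreal (mass w))"
    by (intro sum.cong refl)
      (simp add: nn_integral_cmult_indicator E_sets_\<nu>[OF assms] emeasure_\<nu>_E[OF assms])
  finally show ?thesis .
qed

text \<open>By disjointness only one term survives. Sums of this form thus act as step functions of
  level \<open>n\<close>, which are measurable and whose integrals are given by
  \<open>nn_integral_simple_E\<close>.\<close>

lemma sum_indicator_E:
  assumes "n \<ge> 1" "w \<in> words_of_length I n" "y \<in> E w"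
  shows "(\<Sum>v\<in>words_of_length I n. f v * indicator (E v) y) = (f w :: ennreal)"
proof -
  have "(\<Sum>v\<in>words_of_length I n. f v * indicator (E v) y) =
        (\<Sum>v\<in>words_of_length I n. if v = w then f w else 0)"
    using disjoint_E[OF _ assms(2)] assms(3) by (intro sum.cong) (auto simp: indicator_def)
  then show ?thesis using assms(2) by simp
qed

section \<open>Lower bound for the energy\<close>

lemma energy_ge:
  assumes n: "n \<ge> 1" and s: "0 \<le> s" and R: "0 < R"
    and diam: "\<And>w. w \<in> words_of_length I n \<Longrightarrow> diameter (E w) \<le> R"
  shows "ennreal (R powr - s * sum_sq_mass n) \<le> energy s \<nu>"
proof -
  let ?W = "words_of_length I n"
  \<comment> \<open>For \<open>y\<close> in \<open>E w\<close> only the points \<open>x\<close> of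
    the same \<open>E w\<close> are kept, where the kernel is at least \<open>R powr - s\<close>.
    The result is a step function in \<open>y\<close>, so the outer integral becomes a finite
    sum.\<close>
  have inner: "(\<Sum>w\<in>?W. ennreal (R powr - s * mass w) * indicator (E w) y)
      \<le> (\<integral>\<^sup>+ x. neg_power (dist x y) s \<partial>\<nu>)" for y
  proof (cases "\<exists>w\<in>?W. y \<in> E w")
    case False
    then show ?thesis by (auto intro!: sum_nonpos)
  next
    case True
    then obtain w where w: "w \<in> ?W" "y \<in> E w" by blast
    have "ennreal (R powr - s) * indicator (E w) x \<le> neg_power (dist x y) s" for x
      using dist_le_diameter_E[OF fin_wordsI[OF n w(1)] _ w(2), of x] diam[OF w(1)] s R
      by (auto simp: indicator_def intro: neg_power_ge)
    then have "(\<integral>\<^sup>+ x. ennreal (R powr - s) * indicator (E w) x \<partial>\<nu>)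
        \<le> (\<integral>\<^sup>+ x. neg_power (dist x y) s \<partial>\<nu>)"
      by (intro nn_integral_mono)
    moreover have "(\<integral>\<^sup>+ x. ennreal (R powr - s) * indicator (E w) x \<partial>\<nu>) = ennreal (R powr - s * mass w)"
      by (simp add: nn_integral_cmult_indicator E_sets_\<nu>[OF n w(1)] emeasure_\<nu>_E[OF n w(1)]
          ennreal_mult)
    ultimately show ?thesis
      by (simp only: sum_indicator_E[OF n w])
  qed
  have "ennreal (R powr - s * sum_sq_mass n) = (\<Sum>w\<in>?W. ennreal (R powr - s * mass w) * ennreal (mass w))"
    by (simp add: sum_sq_mass_def sum_distrib_left ennreal_mult[symmetric] power2_eq_square mult.assoc)
  also have "\<dots> = (\<integral>\<^sup>+ y. (\<Sum>w\<in>?W. ennreal (R powr - s * mass w) * indicator (E w) y) \<partial>\<nu>)"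
    by (rule nn_integral_simple_E[OF n, symmetric])
  also have "\<dots> \<le> energy s \<nu>"
    unfolding energy_def by (intro nn_integral_mono inner)
  finally show ?thesis .
qed

section \<open>Upper bound for the energy\<close>

definition near :: "real \<Rightarrow> 's list \<Rightarrow> 's list \<Rightarrow> bool" where
  "near r v w \<longleftrightarrow> (\<exists>x\<in>E v. \<exists>y\<in>E w. dist x y \<le> r)"

lemma near_sym: "near r v w \<Longrightarrow> near r w v"
  unfolding near_def by (metis dist_commute)

text \<open>Almost every point of the ball lies in some \<open>E v\<close> of level
  \<open>n\<close>, and the pair formed by \<open>y\<close> and that point witnesses that
  \<open>v\<close> is near \<open>w\<close>. The bound depends on \<open>w\<close> but not on the
  position of \<open>y\<close> in \<open>E w\<close>.\<close>

lemma emeasure_cball_le: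
  assumes n: "n \<ge> 1" and w: "w \<in> words_of_length I n" "y \<in> E w"
  shows "emeasure \<nu> (cball y r \<inter> X) \<le> ennreal (\<Sum>v | v \<in> words_of_length I n \<and> near r w v. mass v)"
proof -
  let ?V = "{v. v \<in> words_of_length I n \<and> near r w v}"
  have "emeasure \<nu> (cball y r \<inter> X) \<le> emeasure \<nu> (\<Union>v\<in>?V. E v)"
  proof (rule emeasure_mono_AE)
    show "AE x in \<nu>. x \<in> cball y r \<inter> X \<longrightarrow> x \<in> (\<Union>v\<in>?V. E v)"
      using AE_\<nu>_in_E[OF n] by eventually_elim (use w in \<open>auto simp: near_def\<close>)
    show "(\<Union>v\<in>?V. E v) \<in> sets \<nu>"
      using E_sets_\<nu>[OF n] by (intro sets.finite_UN) auto
  qed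
  also have "\<dots> \<le> (\<Sum>v\<in>?V. emeasure \<nu> (E v))"
    using E_sets_\<nu>[OF n] by (intro emeasure_subadditive_finite) auto
  also have "\<dots> = ennreal (\<Sum>v\<in>?V. mass v)"
    using emeasure_\<nu>_E[OF n] by simp
  finally show ?thesis .
qed

text \<open>The inner integral of the energy is only ever compared with measurable functions, so its own
  measurability in \<open>y\<close> is not an issue.\<close>

lemma energy_le_suminf:
  fixes k :: "nat \<Rightarrow> nat" and s \<rho> :: real
  assumes k: "\<And>j. k j \<ge> 1" and \<rho>: "0 < \<rho>" and s: "0 \<le> s"
    and deg: "\<And>j w. w \<in> words_of_length I (k j) \<Longrightarrow>
           card {v \<in> words_of_length I (k j). near (\<rho> / 2 ^ j) w v} \<le> M"
  shows "energy s \<nu> \<le> ennreal (\<rho> powr - s) * emeasure \<nu> (space \<nu>) * emeasure \<nu> (space \<nu>) +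
           (\<Sum>j. ennreal ((\<rho> / 2 ^ Suc j) powr - s * (real M * sum_sq_mass (k j))))"
proof -
  let ?W = "\<lambda>j. words_of_length I (k j)"
  let ?c = "\<lambda>j. (\<rho> / 2 ^ Suc j) powr - s"
  \<comment> \<open>\<open>g j w\<close> is the mass of all neighbours of \<open>w\<close> at scale
    \<open>\<rho> / 2 ^ j\<close>. The step function \<open>h j\<close> takes this value on
    \<open>E w\<close> and so dominates the measure of the ball around \<open>y\<close>, for almost
    every \<open>y\<close>.\<close>
  define g where "g j w = (\<Sum>v | v \<in> ?W j \<and> near (\<rho> / 2 ^ j) w v. mass v)" for j w
  define h where "h j y = (\<Sum>w\<in>?W j. ennreal (g j w) * indicator (E w) y)" for j y
  have g_nonneg: "0 \<le> g j w" for j w by (simp add: g_def sum_nonneg)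
  have h_meas [measurable]: "h j \<in> borel_measurable \<nu>" for j
    unfolding h_def using E_sets_\<nu>[OF k] by measurable
  \<comment> \<open>Integrating the dyadic bound for the kernel term by term turns indicators of
    balls into their measures.\<close>
  have inner: "(\<integral>\<^sup>+ x. neg_power (dist x y) s \<partial>\<nu>)
      \<le> ennreal (\<rho> powr - s) * emeasure \<nu> (space \<nu>) +
        (\<Sum>j. ennreal (?c j) * emeasure \<nu> (cball y (\<rho> / 2 ^ j) \<inter> X))" for y
  proof -
    let ?B = "\<lambda>j. cball y (\<rho> / 2 ^ j) \<inter> X"
    have B [measurable]: "?B j \<in> sets \<nu>" for j by (rule closed_Int_X_sets_\<nu>) simp
    have "(\<integral>\<^sup>+ x. neg_power (dist x y) s \<partial>\<nu>)
        \<le> (\<integral>\<^sup>+ x. ennreal (\<rho> powr - s) + (\<Sum>j. ennreal (?c j) * indicator (?B j) x) \<partial>\<nu>)"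
    proof (rule nn_integral_mono)
      fix x assume "x \<in> space \<nu>"
      then have "x \<in> X" by (simp add: \<nu>_def space_restrict_space)
      then have "(if dist x y \<le> \<rho> / 2 ^ j then 1 else 0) = (indicator (?B j) x :: ennreal)" for j
        by (auto simp: indicator_def dist_commute)
      then show "neg_power (dist x y) s
          \<le> ennreal (\<rho> powr - s) + (\<Sum>j. ennreal (?c j) * indicator (?B j) x)"
        using neg_power_le_suminf[OF \<rho> s, of "dist x y"] by simp
    qed
    also have "\<dots> = ennreal (\<rho> powr - s) * emeasure \<nu> (space \<nu>)
        + (\<Sum>j. ennreal (?c j) * emeasure \<nu> (?B j))"
      using B by (simp add: nn_integral_add nn_integral_suminf nn_integral_cmult_indicator)
    finally show ?thesis .
  qed
  \<comment> \<open>Countably many levels are involved, so one null set serves for all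
    \<open>j\<close>.\<close>
  have "AE y in \<nu>. \<forall>j. \<exists>w\<in>?W j. y \<in> E w"
    using AE_\<nu>_in_E[OF k] by (simp add: AE_all_countable)
  then have "AE y in \<nu>. (\<integral>\<^sup>+ x. neg_power (dist x y) s \<partial>\<nu>)
      \<le> ennreal (\<rho> powr - s) * emeasure \<nu> (space \<nu>) + (\<Sum>j. ennreal (?c j) * h j y)"
  proof eventually_elim
    case (elim y)
    have "emeasure \<nu> (cball y (\<rho> / 2 ^ j) \<inter> X) \<le> h j y" for j
    proof -
      obtain w where w: "w \<in> ?W j" "y \<in> E w" using elim by blast
      show ?thesis
        using emeasure_cball_le[OF k w] unfolding h_def sum_indicator_E[OF k w] g_def .
    qed
    then show ?case
      by (intro order_trans[OF inner] add_left_mono suminf_le summableI mult_left_mono) auto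
  qed
  then have "energy s \<nu> \<le>
      (\<integral>\<^sup>+ y. ennreal (\<rho> powr - s) * emeasure \<nu> (space \<nu>) + (\<Sum>j. ennreal (?c j) * h j y) \<partial>\<nu>)"
    unfolding energy_def by (rule nn_integral_mono_AE)
  also have "\<dots> = ennreal (\<rho> powr - s) * emeasure \<nu> (space \<nu>) * emeasure \<nu> (space \<nu>)
      + (\<Sum>j. ennreal (?c j) * (\<integral>\<^sup>+ y. h j y \<partial>\<nu>))"
    by (simp add: nn_integral_add nn_integral_suminf nn_integral_cmult)
  also have "\<dots> \<le> ennreal (\<rho> powr - s) * emeasure \<nu> (space \<nu>) * emeasure \<nu> (space \<nu>)
      + (\<Sum>j. ennreal (?c j * (real M * sum_sq_mass (k j))))"
  proof (intro add_left_mono suminf_le summableI)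
    fix j
    \<comment> \<open>The integral of \<open>h j\<close> is the sum of products of masses over pairs
      of neighbours, to which the bounded degree estimate applies.\<close>
    have "(\<integral>\<^sup>+ y. h j y \<partial>\<nu>) = ennreal (\<Sum>w\<in>?W j. mass w * g j w)"
      unfolding h_def nn_integral_simple_E[OF k]
      by (simp add: g_nonneg ennreal_mult[symmetric] mult.commute)
    also have "\<dots> \<le> ennreal (real M * sum_sq_mass (k j))"
      unfolding g_def sum_sq_mass_def
      by (intro ennreal_leI sum_bounded_degree_le[OF finite_words near_sym]) (auto intro: deg)
    finally show "ennreal (?c j) * (\<integral>\<^sup>+ y. h j y \<partial>\<nu>) \<le> ennreal (?c j * (real M * sum_sq_mass (k j)))"
      by (simp add: ennreal_mult sum_sq_mass_nonneg mult_left_mono)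
  qed
  finally show ?thesis .
qed

text \<open>With a level chosen by \<open>decay\<close> for each scale
  \<open>\<rho> / 2 ^ j\<close>, the series in \<open>energy_le_suminf\<close> is dominated by a
  geometric one of ratio \<open>2 powr (s - t)\<close>, which is below 1.\<close>

lemma energy_finite:
  assumes \<rho>: "0 < \<rho>" and s: "0 \<le> s" "s < t"
    and decay: "\<And>r. 0 < r \<Longrightarrow> r \<le> \<rho> \<Longrightarrow> \<exists>n\<ge>1. sum_sq_mass n \<le> r powr t \<and>
       (\<forall>w\<in>words_of_length I n. card {v \<in> words_of_length I n. near r w v} \<le> M)"
  shows "energy s \<nu> < \<infinity>"
proof -
  have "\<forall>j. \<exists>n. n \<ge> 1 \<and> sum_sq_mass n \<le> (\<rho> / 2 ^ j) powr t \<and>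
       (\<forall>w\<in>words_of_length I n. card {v \<in> words_of_length I n. near (\<rho> / 2 ^ j) w v} \<le> M)"
    using decay[of "\<rho> / 2 ^ j" for j] \<rho> by (auto simp: divide_le_eq)
  then have "\<exists>k. \<forall>j. k j \<ge> 1 \<and> sum_sq_mass (k j) \<le> (\<rho> / 2 ^ j) powr t \<and>
       (\<forall>w\<in>words_of_length I (k j).
          card {v \<in> words_of_length I (k j). near (\<rho> / 2 ^ j) w v} \<le> M)"
    by (rule choice)
  then obtain k where k: "\<And>j. k j \<ge> 1" "\<And>j. sum_sq_mass (k j) \<le> (\<rho> / 2 ^ j) powr t"
      "\<And>j w. w \<in> words_of_length I (k j) \<Longrightarrow>
        card {v \<in> words_of_length I (k j). near (\<rho> / 2 ^ j) w v} \<le> M"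
    by blast
  let ?f = "\<lambda>j. (\<rho> / 2 ^ Suc j) powr - s * (real M * sum_sq_mass (k j))"
  \<comment> \<open>\<open>A\<close> collects the factors that do not depend on \<open>j\<close>;
    the extra \<open>1 / 2\<close> comes from \<open>Suc j\<close> in the kernel bound.\<close>
  define A where "A = (\<rho> / 2) powr - s * real M * \<rho> powr t"
  have "summable ?f"
  proof (rule summable_comparison_test')
    have "2 powr (s - t) < (1::real)" using powr_less_mono[of "s - t" 0 2] s by simp
    then show "summable (\<lambda>j. A * (2 powr (s - t)) ^ j)"
      by (intro summable_mult summable_geometric) simp
    fix j :: nat
    have "?f j \<le> (\<rho> / 2 ^ Suc j) powr - s * (real M * (\<rho> / 2 ^ j) powr t)"
      using k(2) by (intro mult_left_mono) auto
    also have "\<dots> = A * (2 powr (s - t)) ^ j"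
      using \<rho> unfolding A_def
      by (simp add: powr_divide powr_mult powr_minus powr_diff power_divide powr_power field_simps
          powr_realpow[symmetric] powr_powr)
    finally show "norm (?f j) \<le> A * (2 powr (s - t)) ^ j"
      using sum_sq_mass_nonneg by simp
  qed
  then have "(\<Sum>j. ennreal (?f j)) < \<infinity>"
    using sum_sq_mass_nonneg by (simp add: less_top ennreal_suminf_neq_top)
  moreover have "emeasure \<nu> (space \<nu>) < \<infinity>"
    using finite_measure.emeasure_finite[OF finite_measure_\<nu>] by (simp add: less_top)
  ultimately have "ennreal (\<rho> powr - s) * emeasure \<nu> (space \<nu>) * emeasure \<nu> (space \<nu>) +
      (\<Sum>j. ennreal (?f j)) < \<infinity>"
    by (simp add: ennreal_mult_less_top)
  with energy_le_suminf[of k \<rho> s M, OF k(1) \<rho> s(1) k(3)] show ?thesis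
    by (rule le_less_trans)
qed

end

subsection \<open>The correlation dimension\<close>

locale regular_moran_measure = moran_measure X I E \<mu>
  for X :: "'a::metric_space set" and I :: "nat \<Rightarrow> 's set" and E :: "'s list \<Rightarrow> 'a set"
    and \<mu> :: "(nat \<Rightarrow> 's) measure" +
  fixes \<beta> :: "nat \<Rightarrow> real" and N :: nat and C0 C :: real
  assumes doubling_X: "doubling_with N X"
    and C0_pos: "C0 > 0"
    and M4: "\<forall>w\<in>fin_words I. \<exists>x\<in>E w. cball x (C0 * diameter (E w)) \<inter> X \<subseteq> E w"
    and C_ge_1: "C \<ge> 1"
    and beta_pos: "\<forall>n\<ge>1. \<beta> n > 0"
    and M7: "\<forall>n\<ge>1. \<forall>w\<in>words_of_length I n.
               inverse C * \<beta> n \<le> diameter (E w) \<and> diameter (E w) \<le> C * \<beta> n"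
begin

text \<open>Packing of the centres \<open>x v\<close> of the balls from (M4). The ball of
  \<open>v\<close> lies in \<open>E v\<close>, which misses the other centres, so centres are
  separated by a multiple of \<open>\<beta> n\<close>; those of neighbours of \<open>w\<close> all
  lie in a ball of comparable radius. The condition on \<open>k\<close> matches the two
  constants.\<close>

lemma card_near_le:
  assumes n: "n \<ge> 1" and w: "w \<in> words_of_length I n" and r: "r \<le> \<beta> n"
    and k: "2 * (2 * C + 1) / 2 ^ k \<le> C0 * inverse C"
  shows "card {v \<in> words_of_length I n. near r w v} \<le> N ^ k"
proof -
  let ?W = "words_of_length I n"
  define V where "V = {v \<in> ?W. near r w v}"
  \<comment> \<open>Two diameters, of \<open>E w\<close> and of \<open>E v\<close>, plus a gap of at
    most \<open>\<beta> n\<close> between them.\<close>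
  define R where "R = (2 * C + 1) * \<beta> n"
  have \<beta>: "\<beta> n > 0" using beta_pos n by blast
  have R: "R > 0" using \<beta> C_ge_1 by (simp add: R_def)
  have diam: "inverse C * \<beta> n \<le> diameter (E v)" "diameter (E v) \<le> C * \<beta> n" if "v \<in> ?W" for v
    using M7 n that by blast+
  have "\<forall>v\<in>?W. \<exists>x\<in>E v. cball x (C0 * diameter (E v)) \<inter> X \<subseteq> E v"
    using M4 fin_wordsI[OF n] by blast
  then obtain x where x: "\<And>v. v \<in> ?W \<Longrightarrow> x v \<in> E v"
      "\<And>v. v \<in> ?W \<Longrightarrow> cball (x v) (C0 * diameter (E v)) \<inter> X \<subseteq> E v"
    by metis
  have xX: "x v \<in> X" if "v \<in> ?W" for v
    using x(1)[OF that] E_subset_X[OF fin_wordsI[OF n that]] by blast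
  have sep: "2 * R / 2 ^ k < dist (x v) (x v')" if "v \<in> ?W" "v' \<in> ?W" "v \<noteq> v'" for v v'
  proof -
    have "x v' \<notin> E v" using disjoint_E[OF that] x(1)[OF that(2)] by blast
    then have "C0 * diameter (E v) < dist (x v) (x v')"
      using x(2)[OF that(1)] xX[OF that(2)] by force
    moreover have "C0 * (inverse C * \<beta> n) \<le> C0 * diameter (E v)"
      using diam(1)[OF that(1)] C0_pos by (intro mult_left_mono) auto
    moreover have "2 * R / 2 ^ k \<le> C0 * (inverse C * \<beta> n)"
      using mult_right_mono[OF k, of "\<beta> n"] \<beta> by (simp add: R_def algebra_simps)
    ultimately show ?thesis by linarith
  qed
  obtain y where y: "y \<in> E w" using E_nonempty[OF fin_wordsI[OF n w]] by blast
  have "x ` V \<subseteq> cball y R \<inter> X"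
  proof (intro subsetI IntI)
    fix z assume "z \<in> x ` V"
    then obtain v where v: "v \<in> ?W" "near r w v" "z = x v" by (auto simp: V_def)
    then show "z \<in> X" using xX by simp
    obtain p q where pq: "p \<in> E w" "q \<in> E v" "dist p q \<le> r" using v(2) unfolding near_def by blast
    have "dist y p \<le> C * \<beta> n"
      using dist_le_diameter_E[OF fin_wordsI[OF n w] y pq(1)] diam(2)[OF w] by linarith
    moreover have "dist q (x v) \<le> C * \<beta> n"
      using dist_le_diameter_E[OF fin_wordsI[OF n v(1)] pq(2) x(1)[OF v(1)]] diam(2)[OF v(1)]
      by linarith
    moreover have "dist y (x v) \<le> dist y p + dist p q + dist q (x v)"
      using dist_triangle[of y "x v" p] dist_triangle[of p "x v" q] by linarith
    moreover have "R = 2 * (C * \<beta> n) + \<beta> n" by (simp add: R_def algebra_simps)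
    ultimately show "z \<in> cball y R" using pq(3) r v(3) by simp
  qed
  moreover have "y \<in> X" using y E_subset_X[OF fin_wordsI[OF n w]] by blast
  ultimately have "card (x ` V) \<le> N ^ k"
    using doubling_with_packing[OF doubling_X _ R, of y "x ` V" k] sep unfolding V_def by blast
  moreover have "inj_on x V"
  proof (rule inj_onI, rule ccontr)
    fix v v' assume "v \<in> V" "v' \<in> V" "x v = x v'" "v \<noteq> v'"
    then show False using disjoint_E[of v n v'] x(1)[of v] x(1)[of v'] by (auto simp: V_def)
  qed
  ultimately show ?thesis by (simp add: card_image V_def)
qed

text \<open>The exponent \<open>k\<close> depends on \<open>C\<close> and \<open>C0\<close> only,
  hence one \<open>M\<close> works at all levels.\<close>

lemma card_near_bounded:
  "\<exists>M. \<forall>n\<ge>1. \<forall>r\<le>\<beta> n. \<forall>w\<in>words_of_length I n.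
     card {v \<in> words_of_length I n. near r w v} \<le> M"
proof -
  have C: "C > 0" using C_ge_1 by simp
  obtain k :: nat where "2 * (2 * C + 1) / (C0 * inverse C) < 2 ^ k"
    using real_arch_pow[of 2] by auto
  then have "2 * (2 * C + 1) / 2 ^ k \<le> C0 * inverse C"
    using C0_pos C by (simp add: field_simps)
  then show ?thesis using card_near_le by blast
qed

text \<open>Along any single sequence of symbols \<open>\<beta> n\<close> is at most
  \<open>C\<close> times a diameter, and these diameters tend to 0.\<close>

lemma beta_tendsto_0: "\<beta> \<longlonglongrightarrow> 0"
proof -
  obtain \<sigma> where \<sigma>: "\<sigma> \<in> symb_space I" using symb_space_nonempty by blast
  have C: "C > 0" using C_ge_1 by simp
  have lim: "(\<lambda>n. C * diameter (E (init_word \<sigma> n))) \<longlonglongrightarrow> 0"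
    using tendsto_mult_left[OF diameter_E_tendsto_0[OF \<sigma>], of C] by simp
  have "\<forall>n\<ge>1. norm (\<beta> n) \<le> C * diameter (E (init_word \<sigma> n))"
  proof (intro allI impI)
    fix n :: nat assume n: "n \<ge> 1"
    have "inverse C * \<beta> n \<le> diameter (E (init_word \<sigma> n))"
      using M7 n init_word_in_words_of_length[OF \<sigma>] by blast
    then show "norm (\<beta> n) \<le> C * diameter (E (init_word \<sigma> n))"
      using C beta_pos n by (auto simp: field_simps)
  qed
  then show ?thesis
    by (intro Lim_null_comparison[OF _ lim]) (auto simp: eventually_sequentially)
qed

lemma ln_beta_at_bot: "filterlim (\<lambda>n. ln (\<beta> n)) at_bot sequentially"
proof (rule filterlim_compose[OF ln_at_0])
  show "filterlim \<beta> (at_right 0) sequentially"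
    unfolding filterlim_at eventually_sequentially
    using beta_tendsto_0 beta_pos by force
qed

text \<open>The sign matters: for large \<open>n\<close>, dividing by \<open>ln (\<beta> n)\<close>
  reverses inequalities.\<close>

lemma eventually_beta: "eventually (\<lambda>n. n \<ge> 1 \<and> 0 < \<beta> n \<and> ln (\<beta> n) < 0) sequentially"
proof -
  have "eventually (\<lambda>n. ln (\<beta> n) < 0) sequentially"
    using ln_beta_at_bot by (simp add: filterlim_at_bot_dense)
  then show ?thesis
    using eventually_ge_at_top[of 1] by eventually_elim (use beta_pos in auto)
qed

section \<open>Comparison of the energy with the growth rate\<close>

definition corr_rate :: "nat \<Rightarrow> ereal" where
  "corr_rate n = elog (sum_sq_mass n) / ereal (ln (\<beta> n))"

text \<open>Take logarithms in \<open>energy_ge\<close> with \<open>R = C * \<beta> n\<close>. Both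
  \<open>C\<close> and the energy contribute bounded terms, which vanish after division by
  \<open>ln (\<beta> n)\<close>.\<close>

lemma le_liminf_corr_rate:
  assumes s: "0 \<le> s" and fin: "energy s \<nu> < \<infinity>"
  shows "ereal s \<le> liminf corr_rate"
proof -
  \<comment> \<open>Adding 1 keeps \<open>e\<close> positive even if the energy is 0, so that
    \<open>ln e\<close> is meaningful.\<close>
  define e where "e = enn2real (energy s \<nu>) + 1"
  define g where "g n = s * (ln C / ln (\<beta> n) + 1) + ln e / ln (\<beta> n)" for n
  have e: "e > 0" by (simp add: e_def add_nonneg_pos)
  have inv: "(\<lambda>n. c / ln (\<beta> n)) \<longlonglongrightarrow> 0" for c
    by (intro tendsto_divide_0[OF tendsto_const] filterlim_at_bot_imp_at_infinity ln_beta_at_bot)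
  have "g \<longlonglongrightarrow> s * (0 + 1) + 0"
    unfolding g_def by (intro tendsto_intros inv)
  then have "(\<lambda>n. ereal (g n)) \<longlonglongrightarrow> ereal s" by simp
  then have "ereal s = liminf (\<lambda>n. ereal (g n))"
    by (rule lim_imp_Liminf[OF trivial_limit_sequentially, symmetric])
  also have "\<dots> \<le> liminf corr_rate"
  proof (rule Liminf_mono)
    show "eventually (\<lambda>n. ereal (g n) \<le> corr_rate n) sequentially"
      using eventually_beta
    proof eventually_elim
      case (elim n)
      then have n: "n \<ge> 1" and \<beta>: "0 < \<beta> n" "ln (\<beta> n) < 0" by auto
      have C: "C > 0" using C_ge_1 by simp
      show ?case
      proof (cases "sum_sq_mass n = 0")
        \<comment> \<open>Here \<open>corr_rate n\<close> is \<open>-\<infinity>\<close> divided by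
          a negative number, that is \<open>\<infinity>\<close>.\<close>
        case True
        then show ?thesis using \<beta>(2) by (simp add: corr_rate_def elog_def divide_ereal_def)
      next
        case False
        then have S: "sum_sq_mass n > 0" using sum_sq_mass_nonneg[of n] by simp
        have "ennreal ((C * \<beta> n) powr - s * sum_sq_mass n) \<le> energy s \<nu>"
          using M7 n s \<beta> C by (intro energy_ge) auto
        also have "energy s \<nu> = ennreal (enn2real (energy s \<nu>))" using fin by simp
        also have "\<dots> \<le> ennreal e" by (intro ennreal_leI) (simp add: e_def)
        finally have "(C * \<beta> n) powr - s * sum_sq_mass n \<le> e" using e by (simp add: ennreal_le_iff)
        then have "ln ((C * \<beta> n) powr - s * sum_sq_mass n) \<le> ln e"
          using S \<beta> C e by (subst ln_le_cancel_iff) auto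
        then have "ln (sum_sq_mass n) \<le> s * (ln C + ln (\<beta> n)) + ln e"
          using S \<beta> C by (simp add: ln_mult ln_powr)
        then have "(s * (ln C + ln (\<beta> n)) + ln e) / ln (\<beta> n) \<le> ln (sum_sq_mass n) / ln (\<beta> n)"
          using \<beta>(2) by (intro divide_right_mono_neg) auto
        moreover have "g n = (s * (ln C + ln (\<beta> n)) + ln e) / ln (\<beta> n)"
          using \<beta>(2) by (simp add: g_def field_simps)
        ultimately show ?thesis using S \<beta>(2) by (simp add: corr_rate_def elog_def)
      qed
    qed
  qed
  finally show ?thesis .
qed

lemma sum_sq_mass_le_powr:
  assumes n: "0 < \<beta> n" "ln (\<beta> n) < 0" and t: "ereal t < corr_rate n"
  shows "sum_sq_mass n \<le> \<beta> n powr t"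
proof (cases "sum_sq_mass n = 0")
  case False
  then have S: "sum_sq_mass n > 0" using sum_sq_mass_nonneg[of n] by simp
  then have "t < ln (sum_sq_mass n) / ln (\<beta> n)" using t n(2) by (simp add: corr_rate_def elog_def)
  then have "ln (sum_sq_mass n) < t * ln (\<beta> n)" using n(2) by (simp add: field_simps)
  then have "sum_sq_mass n < exp (t * ln (\<beta> n))" using S by (metis exp_less_cancel_iff exp_ln)
  then show ?thesis using n(1) by (simp add: powr_def)
qed simp

text \<open>Two intermediate exponents \<open>s < u < t\<close> are used: the gap between
  \<open>t\<close> and \<open>u\<close> pays for replacing \<open>\<beta> n\<close> by
  \<open>\<beta> (Suc n)\<close>, and the gap between \<open>u\<close> and \<open>s\<close> makes
  the dyadic series converge.\<close>

lemma energy_finite_if_less_liminf: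
  assumes s: "0 \<le> s" "ereal s < liminf corr_rate"
    and beta_lim: "(\<lambda>n. ln (\<beta> n) / ln (\<beta> (Suc n))) \<longlonglongrightarrow> 1"
  shows "energy s \<nu> < \<infinity>"
proof -
  obtain t where t: "s < t" "ereal t < liminf corr_rate"
    using ereal_dense2[OF s(2)] by auto
  obtain u where u: "s < u" "u < t" using dense[OF t(1)] by blast
  have "u / t < 1" using u s by simp
  \<comment> \<open>From \<open>t\<close> below the liminf,
    \<open>sum_sq_mass n \<le> \<beta> n powr t\<close>. As the ratio of logarithms eventually
    exceeds \<open>u / t\<close> and the logarithms are negative, this is at most
    \<open>\<beta> (Suc n) powr u\<close>.\<close>
  have "eventually (\<lambda>n. (n \<ge> 1 \<and> 0 < \<beta> n \<and> ln (\<beta> n) < 0) \<and> (0 < \<beta> (Suc n) \<and> ln (\<beta> (Suc n)) < 0)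
      \<and> sum_sq_mass n \<le> \<beta> (Suc n) powr u) sequentially"
    using eventually_beta eventually_sequentially_Suc[THEN iffD2, OF eventually_beta]
      order_tendstoD(1)[OF beta_lim \<open>u / t < 1\<close>] less_LiminfD[OF t(2)]
  proof eventually_elim
    case (elim n)
    have "t * (ln (\<beta> n) / ln (\<beta> (Suc n))) > u"
      using elim(3) u s by (simp add: field_simps)
    then have "t * ln (\<beta> n) \<le> u * ln (\<beta> (Suc n))"
      using elim(2) by (simp add: field_simps)
    then have "\<beta> n powr t \<le> \<beta> (Suc n) powr u"
      using elim(1,2) by (simp add: powr_def)
    then show ?case using sum_sq_mass_le_powr[of n t] elim by auto
  qed
  then obtain n0 where n0: "\<And>n. n \<ge> n0 \<Longrightarrow> n \<ge> 1 \<and> 0 < \<beta> n \<and> 0 < \<beta> (Suc n) \<and> sum_sq_mass n \<le> \<beta> (Suc n) powr u"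
    unfolding eventually_sequentially by blast
  obtain M where M: "\<forall>n\<ge>1. \<forall>r\<le>\<beta> n. \<forall>w\<in>words_of_length I n.
      card {v \<in> words_of_length I n. near r w v} \<le> M"
    using card_near_bounded by blast
  show ?thesis
  proof (rule energy_finite)
    show "0 < \<beta> n0" using n0[of n0] by simp
    show "0 \<le> s" "s < u" by fact+
    fix r assume r: "0 < r" "r \<le> \<beta> n0"
    have "eventually (\<lambda>n. \<beta> (Suc n) < r \<and> n \<ge> n0) sequentially"
      using order_tendstoD(2)[OF LIMSEQ_Suc[OF beta_tendsto_0] r(1)] eventually_ge_at_top[of n0]
      by (rule eventually_conj)
    then have ex: "\<exists>n. \<beta> (Suc n) < r \<and> n \<ge> n0"
      using eventually_happens trivial_limit_sequentially by blast
    \<comment> \<open>This level satisfies \<open>\<beta> (Suc n) < r \<le> \<beta> n\<close>: the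
      upper bound controls the number of neighbours at distance \<open>r\<close>, the lower one
      gives \<open>sum_sq_mass n \<le> r powr u\<close>. Minimality replaces monotonicity of
      \<open>\<beta>\<close>; for \<open>n = n0\<close> the upper bound is the restriction on
      \<open>r\<close>.\<close>
    define n where "n = (LEAST n. \<beta> (Suc n) < r \<and> n \<ge> n0)"
    have n: "\<beta> (Suc n) < r" "n \<ge> n0" using LeastI_ex[OF ex] unfolding n_def by auto
    have "r \<le> \<beta> n"
    proof (cases "n = n0")
      case True
      then show ?thesis using r by simp
    next
      case False
      then obtain i where i: "n = Suc i" "i \<ge> n0" using n(2) by (cases n) auto
      then have "i < n" by simp
      then have "\<not> (\<beta> (Suc i) < r \<and> i \<ge> n0)" unfolding n_def by (rule not_less_Least)
      then show ?thesis using i by simp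
    qed
    moreover have "\<beta> (Suc n) powr u \<le> r powr u"
      using n0[OF n(2)] n(1) u s by (intro powr_mono2) auto
    ultimately show "\<exists>n\<ge>1. sum_sq_mass n \<le> r powr u \<and>
        (\<forall>w\<in>words_of_length I n. card {v \<in> words_of_length I n. near r w v} \<le> M)"
      using n0[OF n(2)] M by (intro exI[of _ n]) force
  qed
qed

lemma dim_cor_eq_liminf:
  assumes "(\<lambda>n. ln (\<beta> n) / ln (\<beta> (Suc n))) \<longlonglongrightarrow> 1"
  shows "dim_cor \<nu> = liminf corr_rate"
proof (rule antisym)
  \<comment> \<open>The infimum in \<open>dim_cor\<close> runs over nonnegative \<open>s\<close>
    only. Finiteness of the energy of order 0 makes the liminf nonnegative, so every
    \<open>s\<close> above it is admissible.\<close>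
  have "energy 0 \<nu> = emeasure \<nu> (space \<nu>) * emeasure \<nu> (space \<nu>)"
    by (simp add: energy_def neg_power_def cong: if_cong)
  also have "\<dots> < \<infinity>"
    using finite_measure.emeasure_finite[OF finite_measure_\<nu>]
    by (simp add: less_top[symmetric] ennreal_mult_eq_top_iff)
  finally have nonneg: "0 \<le> liminf corr_rate"
    using le_liminf_corr_rate[of 0] by (simp add: zero_ereal_def)
  show "dim_cor \<nu> \<le> liminf corr_rate"
  proof (rule ccontr)
    assume "\<not> dim_cor \<nu> \<le> liminf corr_rate"
    then have "liminf corr_rate < dim_cor \<nu>" by (simp only: not_le)
    then obtain s where s: "liminf corr_rate < ereal s" "ereal s < dim_cor \<nu>"
      using ereal_dense2 by blast
    then have "0 \<le> s" using nonneg by (metis ereal_less_eq(5) less_imp_le order_trans)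
    moreover have "energy s \<nu> \<noteq> \<infinity>"
    proof
      assume "energy s \<nu> = \<infinity>"
      then have "dim_cor \<nu> \<le> ereal s"
        unfolding dim_cor_def using \<open>0 \<le> s\<close> by (intro INF_lower) simp
      then show False using s(2) by simp
    qed
    ultimately have "ereal s \<le> liminf corr_rate"
      by (intro le_liminf_corr_rate) (simp_all add: less_top)
    then show False using s(1) by simp
  qed
  show "liminf corr_rate \<le> dim_cor \<nu>"
    unfolding dim_cor_def
  proof (rule INF_greatest)
    fix s assume "s \<in> {s. 0 \<le> s \<and> energy s \<nu> = \<infinity>}"
    then have "0 \<le> s" "\<not> energy s \<nu> < \<infinity>" by auto
    then have "\<not> ereal s < liminf corr_rate"
      using energy_finite_if_less_liminf[OF _ _ assms] by blast
    then show "liminf corr_rate \<le> ereal s" by simp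
  qed
qed

end

theorem corollary3p2:
  fixes X :: "'a::metric_space set"
    and I :: "nat \<Rightarrow> 's set"
    and E :: "'s list \<Rightarrow> 'a set"
    and \<beta> :: "nat \<Rightarrow> real"
    and \<mu> :: "(nat \<Rightarrow> 's) measure"
  assumes "compact X" and "doubling X"
    and alphabets: "\<forall>j\<ge>1. finite (I j) \<and> I j \<noteq> {}"
    and moran: "moran_construction X I E"
    and M3: "\<forall>w i j. w @ [i] \<in> fin_words I \<and> w @ [j] \<in> fin_words I \<and> i \<noteq> j \<longrightarrow>
               E (w @ [i]) \<inter> E (w @ [j]) = {}"
    and M4: "\<exists>C0>0. \<forall>w\<in>fin_words I. \<exists>x\<in>E w. cball x (C0 * diameter (E w)) \<inter> X \<subseteq> E w"
    and beta_pos: "\<forall>n\<ge>1. \<beta> n > 0"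
    and beta_lim: "(\<lambda>n. ln (\<beta> n) / ln (\<beta> (Suc n))) \<longlonglongrightarrow> 1"
    and M7: "\<exists>C\<ge>1. \<forall>n\<ge>1. \<forall>w\<in>words_of_length I n.
               inverse C * \<beta> n \<le> diameter (E w) \<and> diameter (E w) \<le> C * \<beta> n"
    and measure: "finite_borel_measure_on (symb_topology I) \<mu>"
  shows "dim_cor (distr \<mu> (restrict_space borel X) (moran_proj E)) =
           liminf (\<lambda>n. elog (\<Sum>w\<in>words_of_length I n. (measure \<mu> (cylinder I w))\<^sup>2)
                        / ereal (ln (\<beta> n)))"
proof -
  obtain N where N: "doubling_with N X"
    using \<open>doubling X\<close> unfolding doubling_iff_doubling_with by blast
  obtain C0 where C0: "C0 > 0"
      "\<forall>w\<in>fin_words I. \<exists>x\<in>E w. cball x (C0 * diameter (E w)) \<inter> X \<subseteq> E w"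
    using M4 by blast
  obtain C where C: "C \<ge> 1" "\<forall>n\<ge>1. \<forall>w\<in>words_of_length I n.
      inverse C * \<beta> n \<le> diameter (E w) \<and> diameter (E w) \<le> C * \<beta> n"
    using M7 by blast
  interpret regular_moran_measure X I E \<mu> \<beta> N C0 C
    by unfold_locales (fact alphabets moran M3 measure N C0 C beta_pos)+
  have "liminf corr_rate =
      liminf (\<lambda>n. elog (\<Sum>w\<in>words_of_length I n. (measure \<mu> (cylinder I w))\<^sup>2) / ereal (ln (\<beta> n)))"
    by (simp add: corr_rate_def[abs_def] sum_sq_mass_def mass_def)
  then show ?thesis
    using dim_cor_eq_liminf[OF beta_lim] by (simp add: \<nu>_def)
qed

end
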